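(* Let $E$ be a real normed space and let $F:=C_{\mathrm{ph}}(B_{E^*},\mathrm{w}^* )$ be the space of positively homogeneous weak* continuous functions on the closed unit ball $B_{E^*}$ of $E^*$. Then $F$ is isomorphic (as a vector lattice) to $C_{\mathrm{ph}}(E^*,\mathrm{bw}^* )$, and the latter is a regular sublattice of $C(E^*,\mathrm{bw}^* )$.
   Context: A function $f$ on $B_{E^*}$ is positively homogeneous if $f(tx)=tf(x)$ for $x\in B_{E^*}$, $0\le t\le 1$; a function $f$ on $E^*$ is positively homogeneous if $f(tx)=tf(x)$ for $x\in E^*$, $t\ge0$. The bounded weak* topology $\mathrm{bw}^*$ on $E^*$ is the strongest topology which agrees with the weak* topology on the norm bounded subsets of $E^*$. $C(E^*,\mathrm{bw}^* )$ is the vector lattice of all real $\mathrm{bw}^*$-continuous functions on $E^*$ with pointwise operations, and $C_{\mathrm{ph}}(E^*,\mathrm{bw}^* )$ is its sublattice of positively homogeneous functions. A sublattice $H$ of a vector lattice $G$ is regular if whenever $P\subset H$ has infimum $0$ in $H$, it has infimum $0$ in $G$. *)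

theory Defs
  imports "HOL-Analysis.Analysis" "HOL-Algebra.Lattice" "HOL-Algebra.Group"
begin

section \<open>Real vector lattices\<close>

record 'v vlat = "'v gorder" +
  vadd :: "'v \<Rightarrow> 'v \<Rightarrow> 'v"
  vzero :: 'v
  vscale :: "real \<Rightarrow> 'v \<Rightarrow> 'v"

locale vector_lattice = Lattice.lattice V for V :: "('v, 'm) vlat_scheme" (structure) +
  assumes add_comm_group:
      "comm_group \<lparr>carrier = carrier V, mult = vadd V, one = vzero V\<rparr>"
    and scale_closed: "x \<in> carrier V \<Longrightarrow> vscale V c x \<in> carrier V"
    and scale_add_right: "\<lbrakk>x \<in> carrier V; y \<in> carrier V\<rbrakk> \<Longrightarrow>
      vscale V c (vadd V x y) = vadd V (vscale V c x) (vscale V c y)"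
    and scale_add_left: "x \<in> carrier V \<Longrightarrow>
      vscale V (c + d) x = vadd V (vscale V c x) (vscale V d x)"
    and scale_scale: "x \<in> carrier V \<Longrightarrow> vscale V c (vscale V d x) = vscale V (c * d) x"
    and scale_one: "x \<in> carrier V \<Longrightarrow> vscale V 1 x = x"
    and add_mono: "\<lbrakk>x \<in> carrier V; y \<in> carrier V; z \<in> carrier V; le V x y\<rbrakk> \<Longrightarrow>
      le V (vadd V x z) (vadd V y z)"
    and scale_mono: "\<lbrakk>x \<in> carrier V; y \<in> carrier V; le V x y; 0 \<le> c\<rbrakk> \<Longrightarrow>
      le V (vscale V c x) (vscale V c y)"

definition vlat_hom :: "'v vlat \<Rightarrow> 'w vlat \<Rightarrow> ('v \<Rightarrow> 'w) set" where
  "vlat_hom V W = {\<phi> \<in> carrier V \<rightarrow> carrier W.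
     (\<forall>x\<in>carrier V. \<forall>y\<in>carrier V.
        \<phi> (vadd V x y) = vadd W (\<phi> x) (\<phi> y) \<and>
        \<phi> (join V x y) = join W (\<phi> x) (\<phi> y) \<and>
        \<phi> (meet V x y) = meet W (\<phi> x) (\<phi> y)) \<and>
     (\<forall>c. \<forall>x\<in>carrier V. \<phi> (vscale V c x) = vscale W c (\<phi> x))}"

definition vlat_isomorphic :: "'v vlat \<Rightarrow> 'w vlat \<Rightarrow> bool" where
  "vlat_isomorphic V W \<longleftrightarrow> vector_lattice V \<and> vector_lattice W \<and>
     (\<exists>\<phi>\<in>vlat_hom V W. bij_betw \<phi> (carrier V) (carrier W))"

definition vector_sublattice :: "'v vlat \<Rightarrow> 'v vlat \<Rightarrow> bool" where
  "vector_sublattice H G \<longleftrightarrow> vector_lattice G \<and>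
     H = G\<lparr>carrier := carrier H\<rparr> \<and> carrier H \<subseteq> carrier G \<and> vzero G \<in> carrier H \<and>
     (\<forall>x\<in>carrier H. \<forall>y\<in>carrier H.
        vadd G x y \<in> carrier H \<and> join G x y \<in> carrier H \<and> meet G x y \<in> carrier H) \<and>
     (\<forall>c. \<forall>x\<in>carrier H. vscale G c x \<in> carrier H)"

text \<open>
  Infima are taken of nonempty sets. The empty set has infimum \<open>0\<close> in a vector lattice
  only if that lattice is \<open>{0}\<close>; admitting it would make the sublattice \<open>{0}\<close> of any nonzero
  vector lattice irregular.
\<close>

definition regular_sublattice :: "'v vlat \<Rightarrow> 'v vlat \<Rightarrow> bool" where
  "regular_sublattice H G \<longleftrightarrow> vector_sublattice H G \<and>
     (\<forall>P. P \<noteq> {} \<longrightarrow> P \<subseteq> carrier H \<longrightarrow>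
        is_glb H (vzero H) P \<longrightarrow> is_glb G (vzero G) P)"

section \<open>The weak* and bounded weak* topologies\<close>

text \<open>
  For scalar-valued maps the strong operator topology, i.e. the topology of pointwise
  convergence, is the weak* topology of the dual.
\<close>

abbreviation weak_star :: "('a::real_normed_vector \<Rightarrow>\<^sub>L real) topology" where
  "weak_star \<equiv> strong_operator_topology"

definition agrees_with_weak_star_on_bounded ::
    "('a::real_normed_vector \<Rightarrow>\<^sub>L real) topology \<Rightarrow> bool" where
  "agrees_with_weak_star_on_bounded T \<longleftrightarrow>
     (\<forall>B. bounded B \<longrightarrow> subtopology T B = subtopology weak_star B)"

definition bw_star :: "('a::real_normed_vector \<Rightarrow>\<^sub>L real) topology" where
  "bw_star = (THE T. agrees_with_weak_star_on_bounded T \<and>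
     (\<forall>T'. agrees_with_weak_star_on_bounded T' \<longrightarrow> (\<forall>U. openin T' U \<longrightarrow> openin T U)))"

text \<open>The strongest such topology exists, so the description above is proper.\<close>

lemma
  shows agrees_bw_star:
      "agrees_with_weak_star_on_bounded (bw_star :: ('a::real_normed_vector \<Rightarrow>\<^sub>L real) topology)"
    and bw_star_strongest: "\<And>(T :: ('a \<Rightarrow>\<^sub>L real) topology) U.
      agrees_with_weak_star_on_bounded T \<Longrightarrow> openin T U \<Longrightarrow> openin bw_star U"
    and openin_bw_star_iff: "\<And>U :: ('a \<Rightarrow>\<^sub>L real) set. openin bw_star U \<longleftrightarrow>
      (\<forall>B. bounded B \<longrightarrow> openin (subtopology weak_star B) (U \<inter> B))"
proof -
  define O' where "O' = (\<lambda>U :: ('a \<Rightarrow>\<^sub>L real) set.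
    \<forall>B. bounded B \<longrightarrow> openin (subtopology weak_star B) (U \<inter> B))"
  have "istopology O'"
    unfolding istopology_def
  proof (intro conjI allI impI)
    fix S T assume "O' S" "O' T"
    moreover have "S \<inter> T \<inter> B = (S \<inter> B) \<inter> (T \<inter> B)" for B by auto
    ultimately show "O' (S \<inter> T)"
      unfolding O'_def by (simp add: openin_Int)
  next
    fix \<K> assume *: "\<forall>K\<in>\<K>. O' K"
    show "O' (\<Union>\<K>)"
      unfolding O'_def
    proof (intro allI impI)
      fix B :: "('a \<Rightarrow>\<^sub>L real) set" assume "bounded B"
      then have "openin (subtopology weak_star B) (\<Union>((\<lambda>K. K \<inter> B) ` \<K>))"
        using * unfolding O'_def by (intro openin_Union) auto
      also have "\<Union>((\<lambda>K. K \<inter> B) ` \<K>) = \<Union>\<K> \<inter> B" by auto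
      finally show "openin (subtopology weak_star B) (\<Union>\<K> \<inter> B)" .
    qed
  qed
  then have op: "openin (topology O') = O'" by simp
  have agr: "agrees_with_weak_star_on_bounded (topology O')"
    unfolding agrees_with_weak_star_on_bounded_def topology_eq
  proof (intro allI impI iffI)
    fix B U :: "('a \<Rightarrow>\<^sub>L real) set"
    assume "bounded B" "openin (subtopology (topology O') B) U"
    then obtain V where "O' V" "U = V \<inter> B"
      unfolding openin_subtopology[of "topology O'"] op by blast
    with \<open>bounded B\<close> show "openin (subtopology weak_star B) U"
      unfolding O'_def by blast
  next
    fix B U :: "('a \<Rightarrow>\<^sub>L real) set"
    assume "bounded B" "openin (subtopology weak_star B) U"
    then obtain V where V: "openin weak_star V" "U = V \<inter> B"
      unfolding openin_subtopology by blast
    then have "O' V"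
      unfolding O'_def openin_subtopology by blast
    with V show "openin (subtopology (topology O') B) U"
      unfolding openin_subtopology op by blast
  qed
  have str: "O' U" if "agrees_with_weak_star_on_bounded T" "openin T U" for T U
    unfolding O'_def
  proof (intro allI impI)
    fix B :: "('a \<Rightarrow>\<^sub>L real) set" assume "bounded B"
    then have "subtopology T B = subtopology weak_star B"
      using that(1) unfolding agrees_with_weak_star_on_bounded_def by blast
    moreover have "openin (subtopology T B) (U \<inter> B)"
      unfolding openin_subtopology using that(2) by blast
    ultimately show "openin (subtopology weak_star B) (U \<inter> B)" by simp
  qed
  have eq: "bw_star = topology O'"
    unfolding bw_star_def
  proof (rule the_equality)
    show "agrees_with_weak_star_on_bounded (topology O') \<and>
      (\<forall>T'. agrees_with_weak_star_on_bounded T' \<longrightarrow>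
        (\<forall>U. openin T' U \<longrightarrow> openin (topology O') U))"
      using agr str op by simp
  next
    fix T :: "('a \<Rightarrow>\<^sub>L real) topology"
    assume T: "agrees_with_weak_star_on_bounded T \<and>
      (\<forall>T'. agrees_with_weak_star_on_bounded T' \<longrightarrow> (\<forall>U. openin T' U \<longrightarrow> openin T U))"
    then have "openin T U \<longleftrightarrow> openin (topology O') U" for U
      using agr str[of T U] op by auto
    then show "T = topology O'"
      unfolding topology_eq by blast
  qed
  show "agrees_with_weak_star_on_bounded (bw_star :: ('a \<Rightarrow>\<^sub>L real) topology)"
    using agr eq by simp
  show "\<And>(T :: ('a \<Rightarrow>\<^sub>L real) topology) U.
      agrees_with_weak_star_on_bounded T \<Longrightarrow> openin T U \<Longrightarrow> openin bw_star U"
    using str eq op by simp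
  show "\<And>U :: ('a \<Rightarrow>\<^sub>L real) set. openin bw_star U \<longleftrightarrow>
      (\<forall>B. bounded B \<longrightarrow> openin (subtopology weak_star B) (U \<inter> B))"
    using eq op O'_def by simp
qed

section \<open>Lattices of continuous functions\<close>

text \<open>
  Functions on \<open>topspace T\<close> are represented by their extensional versions, so that distinct
  elements of the carrier differ at some point of the space.
\<close>

definition C_lattice :: "'x topology \<Rightarrow> ('x \<Rightarrow> real) vlat" where
  "C_lattice T =
     \<lparr>carrier = {f \<in> extensional (topspace T). continuous_map T euclideanreal f},
      eq = (=),
      le = (\<lambda>f g. \<forall>x\<in>topspace T. f x \<le> g x),
      vadd = (\<lambda>f g. \<lambda>x\<in>topspace T. f x + g x),
      vzero = (\<lambda>x\<in>topspace T. 0),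
      vscale = (\<lambda>c f. \<lambda>x\<in>topspace T. c * f x)\<rparr>"

definition pos_homogeneous_ball :: "('b::real_normed_vector \<Rightarrow> real) \<Rightarrow> bool" where
  "pos_homogeneous_ball f \<longleftrightarrow>
     (\<forall>x\<in>cball 0 1. \<forall>t. 0 \<le> t \<and> t \<le> 1 \<longrightarrow> f (t *\<^sub>R x) = t * f x)"

definition pos_homogeneous :: "('b::real_vector \<Rightarrow> real) \<Rightarrow> bool" where
  "pos_homogeneous f \<longleftrightarrow> (\<forall>x. \<forall>t\<ge>0. f (t *\<^sub>R x) = t * f x)"

definition C_ph_ball :: "(('a::real_normed_vector \<Rightarrow>\<^sub>L real) \<Rightarrow> real) vlat" where
  "C_ph_ball = (let C = C_lattice (subtopology weak_star (cball 0 1))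
     in C\<lparr>carrier := {f \<in> carrier C. pos_homogeneous_ball f}\<rparr>)"

definition C_ph_bw_star :: "(('a::real_normed_vector \<Rightarrow>\<^sub>L real) \<Rightarrow> real) vlat" where
  "C_ph_bw_star = (let C = C_lattice bw_star
     in C\<lparr>carrier := {f \<in> carrier C. pos_homogeneous f}\<rparr>)"

end

theory Submission
  imports Defs
begin

text \<open>
  A function on the dual is bw*-continuous iff it is weak*-continuous on every closed ball
  around \<open>0\<close>, so a positively homogeneous weak*-continuous function on the unit ball extends by
  \<open>f x = s f (x / s)\<close>, \<open>s \<ge> \<parallel>x\<parallel>\<close>; this extension is the lattice isomorphism.

  For regularity, let \<open>P\<close> have infimum \<open>0\<close> among the positively homogeneous functions, let the
  bw*-continuous function \<open>g\<close> be a lower bound of \<open>P\<close>, and suppose \<open>g x\<^sub>0 > 0\<close>. Pick \<open>e\<close> with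
  \<open>x\<^sub>0 e = 1\<close> and put \<open>k = min (max g 0) 1\<close>. The function \<open>h x = (x e)\<^sup>+ k (x / x e)\<close> is positively
  homogeneous and is a lower bound of \<open>P\<close> because each \<open>p \<in> P\<close> is homogeneous. As \<open>k\<close> is
  bounded, \<open>h\<close> is on every ball a uniform limit of the functions
  \<open>(x e)\<^sup>+ k (x / max a (x e))\<close>, \<open>a \<rightarrow> 0\<close>, whence it is bw*-continuous. But \<open>h x\<^sub>0 > 0\<close>.
\<close>

section \<open>Lattices of continuous functions with pointwise operations\<close>

lemma C_lattice_simps [simp]:
  "carrier (C_lattice T) = {f \<in> extensional (topspace T). continuous_map T euclideanreal f}"
  "eq (C_lattice T) = (=)"
  "le (C_lattice T) f g = (\<forall>x\<in>topspace T. f x \<le> g x)"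
  "vadd (C_lattice T) f g = (\<lambda>x\<in>topspace T. f x + g x)"
  "vzero (C_lattice T) = (\<lambda>x\<in>topspace T. 0)"
  "vscale (C_lattice T) c f = (\<lambda>x\<in>topspace T. c * f x)"
  by (simp_all add: C_lattice_def)

text \<open>Treats the lattice of all continuous functions and both lattices of positively
  homogeneous ones at once. Closure under maxima is enough, since minima arise from them by
  negation.\<close>

locale pointwise_sublattice =
  fixes T :: "'x topology" and A :: "('x \<Rightarrow> real) set"
  assumes sub: "A \<subseteq> carrier (C_lattice T)"
    and zero_closed: "(\<lambda>x\<in>topspace T. 0) \<in> A"
    and add_closed: "\<And>f g. f \<in> A \<Longrightarrow> g \<in> A \<Longrightarrow> (\<lambda>x\<in>topspace T. f x + g x) \<in> A"
    and scale_closed: "\<And>c f. f \<in> A \<Longrightarrow> (\<lambda>x\<in>topspace T. c * f x) \<in> A"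
    and max_closed: "\<And>f g. f \<in> A \<Longrightarrow> g \<in> A \<Longrightarrow> (\<lambda>x\<in>topspace T. max (f x) (g x)) \<in> A"
begin

abbreviation V where "V \<equiv> (C_lattice T)\<lparr>carrier := A\<rparr>"

lemma ext: "f \<in> A \<Longrightarrow> f \<in> extensional (topspace T)"
  using sub by (auto simp: C_lattice_def)

lemma fun_eqI: "f \<in> A \<Longrightarrow> g \<in> A \<Longrightarrow> (\<And>x. x \<in> topspace T \<Longrightarrow> f x = g x) \<Longrightarrow> f = g"
  using ext by (meson extensionalityI)

lemma restrict_eqI: "f \<in> A \<Longrightarrow> (\<And>x. x \<in> topspace T \<Longrightarrow> g x = f x) \<Longrightarrow> restrict g (topspace T) = f"
  using ext[of f] by (intro extensionalityI[of _ "topspace T"]) auto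

lemma min_closed: "(\<lambda>x\<in>topspace T. min (f x) (g x)) \<in> A" if "f \<in> A" "g \<in> A"
proof -
  define n where "n = (\<lambda>h::'x \<Rightarrow> real. \<lambda>x\<in>topspace T. (-1) * h x)"
  have "n (\<lambda>x\<in>topspace T. max (n f x) (n g x)) \<in> A"
    unfolding n_def using that by (intro scale_closed max_closed)
  also have "n (\<lambda>x\<in>topspace T. max (n f x) (n g x)) = (\<lambda>x\<in>topspace T. min (f x) (g x))"
    by (simp add: n_def restrict_def fun_eq_iff minus_max_eq_min)
  finally show ?thesis .
qed

lemma least_max:
  "f \<in> A \<Longrightarrow> g \<in> A \<Longrightarrow> least V (\<lambda>x\<in>topspace T. max (f x) (g x)) (Upper V {f, g})"
  using max_closed by (auto simp: least_def Upper_def)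

lemma greatest_min:
  "f \<in> A \<Longrightarrow> g \<in> A \<Longrightarrow> greatest V (\<lambda>x\<in>topspace T. min (f x) (g x)) (Lower V {f, g})"
  using min_closed by (auto simp: greatest_def Lower_def)

lemma partial_order: "Order.partial_order V"
proof unfold_locales
  fix f g assume "le V f g" "le V g f" "f \<in> carrier V" "g \<in> carrier V"
  then show "eq V f g"
    by (auto intro!: fun_eqI intro: order_antisym)
qed (auto intro: order_trans)

sublocale Lattice.lattice V
proof (intro Lattice.lattice.intro upper_semilattice.intro lower_semilattice.intro partial_order)
  show "upper_semilattice_axioms V"
    by unfold_locales (use least_max in auto)
  show "lower_semilattice_axioms V"
    by unfold_locales (use greatest_min in auto)
qed

text \<open>Only upper bounds within \<open>A\<close> count for this join, but the pointwise maximum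
  lies in \<open>A\<close> and is the least of them. Hence joins do not depend on the choice of
  \<open>A\<close>.\<close>

lemma join_eq: "join V f g = (\<lambda>x\<in>topspace T. max (f x) (g x))" if "f \<in> A" "g \<in> A"
proof (rule joinI)
  fix l assume l: "least V l (Upper V {f, g})"
  show "l = (\<lambda>x\<in>topspace T. max (f x) (g x))"
    using that by (intro least_unique[OF l] least_max)
qed (use that in auto)

lemma meet_eq: "meet V f g = (\<lambda>x\<in>topspace T. min (f x) (g x))" if "f \<in> A" "g \<in> A"
proof (rule meetI)
  fix l assume l: "greatest V l (Lower V {f, g})"
  show "l = (\<lambda>x\<in>topspace T. min (f x) (g x))"
    using that by (intro greatest_unique[OF l] greatest_min)
qed (use that in auto)

lemma comm_group: "comm_group \<lparr>carrier = carrier V, mult = vadd V, one = vzero V\<rparr>"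
proof (rule comm_groupI; simp)
  fix f assume "f \<in> A"
  then show "\<exists>g\<in>A. (\<lambda>x\<in>topspace T. g x + f x) = (\<lambda>x\<in>topspace T. 0)"
    by (intro bexI[of _ "\<lambda>x\<in>topspace T. (-1) * f x"] scale_closed) auto
qed (auto simp: zero_closed add_closed algebra_simps intro!: restrict_eqI cong: restrict_cong)

lemma vector_lattice: "vector_lattice V"
  by (intro vector_lattice.intro vector_lattice_axioms.intro lattice_axioms comm_group)
     (auto simp: scale_closed algebra_simps mult_left_mono intro!: restrict_eqI cong: restrict_cong)

end

lemma pointwise_sublattice_C_lattice: "pointwise_sublattice T (carrier (C_lattice T))"
  by unfold_locales
     (auto intro: continuous_map_eq[of _ _ "\<lambda>x. _ x + _ x"] continuous_map_eq[of _ _ "\<lambda>x. _ * _ x"]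
        continuous_map_eq[of _ _ "\<lambda>x. max (_ x) (_ x)"] continuous_map_eq[of _ _ "\<lambda>x. 0"]
        continuous_map_add continuous_map_real_mult_left continuous_map_real_max)

section \<open>The weak* and bounded weak* topologies\<close>

lemma topspace_weak_star [simp]: "topspace weak_star = UNIV"
  by (rule strong_operator_topology_topspace)

lemma topspace_bw_star [simp]: "topspace bw_star = UNIV"
proof -
  have "openin bw_star (UNIV :: ('a \<Rightarrow>\<^sub>L real) set)"
    unfolding openin_bw_star_iff by (metis Int_UNIV_left inf_top.right_neutral openin_topspace
        topspace_subtopology topspace_weak_star)
  then show ?thesis
    by (metis openin_subset top.extremum_uniqueI)
qed

text \<open>Openness in \<open>bw_star\<close> is tested on bounded sets, and each of these lies in
  a ball around \<open>0\<close>; conversely, \<open>bw_star\<close> induces the weak* topology on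
  every such ball.\<close>

lemma continuous_map_bw_star_iff:
  fixes f :: "('a::real_normed_vector \<Rightarrow>\<^sub>L real) \<Rightarrow> real"
  shows "continuous_map bw_star euclideanreal f \<longleftrightarrow>
    (\<forall>r>0. continuous_map (subtopology weak_star (cball 0 r)) euclideanreal f)"
proof (intro iffI allI impI)
  fix r :: real
  assume "continuous_map bw_star euclideanreal f"
  then have "continuous_map (subtopology bw_star (cball 0 r)) euclideanreal f"
    by (rule continuous_map_from_subtopology)
  then show "continuous_map (subtopology weak_star (cball 0 r)) euclideanreal f"
    using agrees_bw_star bounded_cball unfolding agrees_with_weak_star_on_bounded_def by metis
next
  assume f: "\<forall>r>0. continuous_map (subtopology weak_star (cball 0 r)) euclideanreal f"
  show "continuous_map bw_star euclideanreal f"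
    unfolding continuous_map_def
  proof (intro conjI allI impI)
    fix U :: "real set" assume U: "openin euclideanreal U"
    show "openin bw_star {x \<in> topspace bw_star. f x \<in> U}"
      unfolding openin_bw_star_iff
    proof (intro allI impI)
      fix B :: "('a \<Rightarrow>\<^sub>L real) set" assume "bounded B"
      then obtain r where "r > 0" and B: "B \<subseteq> cball 0 r"
        by (metis bounded_subset_ballD ball_subset_cball order_trans)
      with f have "continuous_map (subtopology weak_star B) euclideanreal f"
        by (metis continuous_map_from_subtopology_mono)
      with U have "openin (subtopology weak_star B) {x \<in> topspace (subtopology weak_star B). f x \<in> U}"
        unfolding continuous_map_def by blast
      then show "openin (subtopology weak_star B) ({x \<in> topspace bw_star. f x \<in> U} \<inter> B)"
        by (simp add: Int_def conj_commute)
    qed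
  qed simp
qed

text \<open>The point \<open>x /\<^sub>R t\<close> is \<open>s / t \<le> 1\<close> times the point
  \<open>x /\<^sub>R s\<close> of the unit ball, and homogeneity takes this factor out.\<close>

lemma pos_homogeneous_ball_rescale:
  assumes f: "pos_homogeneous_ball f" and "0 < s" "s \<le> t" "norm x \<le> s"
  shows "t * f (x /\<^sub>R t) = s * f (x /\<^sub>R s)"
proof -
  have "f ((s / t) *\<^sub>R (x /\<^sub>R s)) = (s / t) * f (x /\<^sub>R s)"
    using f[unfolded pos_homogeneous_ball_def, rule_format, of "x /\<^sub>R s" "s / t"] assms
    by (simp add: field_simps)
  moreover have "(s / t) *\<^sub>R (x /\<^sub>R s) = x /\<^sub>R t"
    using assms by (simp add: inverse_eq_divide)
  ultimately have "f (x /\<^sub>R t) = (s / t) * f (x /\<^sub>R s)" by (simp only:)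
  then show ?thesis using assms by simp
qed

text \<open>Evaluated at a vector \<open>v\<close>, the map
  \<open>\<lambda>x. c x *\<^sub>R x\<close> is the product of the continuous functions
  \<open>c x\<close> and \<open>x v\<close>, so it is weak*-continuous. The bound by
  \<open>s\<close> keeps its values in the ball on which \<open>f\<close> is known to be
  continuous.\<close>

lemma continuous_map_rescale:
  assumes f: "continuous_map (subtopology weak_star (cball 0 s)) euclideanreal f"
    and c: "continuous_map (subtopology weak_star B) euclideanreal c"
    and B: "\<And>x. x \<in> B \<Longrightarrow> norm (c x *\<^sub>R x) \<le> s"
  shows "continuous_map (subtopology weak_star B) euclideanreal (\<lambda>x. f (c x *\<^sub>R x))"
proof -
  have "continuous_map (subtopology weak_star B) weak_star (\<lambda>x. c x *\<^sub>R x)"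
    unfolding continuous_on_strong_operator_topo_iff_coordinatewise
    by (auto simp: blinfun.scaleR_left intro!: continuous_map_real_mult[OF c]
        continuous_map_from_subtopology[OF strong_operator_topology_continuous_evaluation])
  then have "continuous_map (subtopology weak_star B) (subtopology weak_star (cball 0 s)) (\<lambda>x. c x *\<^sub>R x)"
    using B by (auto simp: continuous_map_in_subtopology)
  from continuous_map_compose[OF this f] show ?thesis by (simp add: o_def)
qed

section \<open>The two lattices of positively homogeneous functions\<close>

lemma C_ph_ball_simps [simp]:
  "le C_ph_ball f g = (\<forall>x\<in>cball 0 1. f x \<le> g x)"
  "vadd C_ph_ball f g = (\<lambda>x\<in>cball 0 1. f x + g x)"
  "vzero C_ph_ball = (\<lambda>x\<in>cball 0 1. 0)"
  "vscale C_ph_ball c f = (\<lambda>x\<in>cball 0 1. c * f x)"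
  by (simp_all add: C_ph_ball_def Let_def)

lemma C_ph_bw_star_simps [simp]:
  "le C_ph_bw_star f g = (\<forall>x. f x \<le> g x)"
  "vadd C_ph_bw_star f g = (\<lambda>x. f x + g x)"
  "vzero C_ph_bw_star = (\<lambda>x. 0)"
  "vscale C_ph_bw_star c f = (\<lambda>x. c * f x)"
  by (simp_all add: C_ph_bw_star_def Let_def restrict_UNIV)

lemma carrier_C_ph_ball:
  "f \<in> carrier C_ph_ball \<longleftrightarrow> f \<in> extensional (cball 0 1) \<and>
     continuous_map (subtopology weak_star (cball 0 1)) euclideanreal f \<and> pos_homogeneous_ball f"
  by (auto simp: C_ph_ball_def Let_def)

lemma carrier_C_ph_bw_star:
  "f \<in> carrier C_ph_bw_star \<longleftrightarrow> continuous_map bw_star euclideanreal f \<and> pos_homogeneous f"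
  by (auto simp: C_ph_bw_star_def Let_def)

lemma pos_homogeneous_ball_0: "pos_homogeneous_ball f \<Longrightarrow> f 0 = 0"
  unfolding pos_homogeneous_ball_def
  by (metis centre_in_cball mult_zero_left order_refl scaleR_zero_left zero_le_one)

lemma scaleR_in_cball:
  fixes x :: "'a::real_normed_vector"
  shows "x \<in> cball 0 1 \<Longrightarrow> 0 \<le> t \<Longrightarrow> t \<le> 1 \<Longrightarrow> t *\<^sub>R x \<in> cball 0 1"
  unfolding mem_cball_0 by (simp add: mult_le_one)

text \<open>The closure conditions hold because a factor \<open>t \<ge> 0\<close> distributes over
  sums and maxima and commutes with real scaling.\<close>

interpretation ball: pointwise_sublattice "subtopology weak_star (cball 0 1)"
    "carrier (C_ph_ball :: (('a::real_normed_vector \<Rightarrow>\<^sub>L real) \<Rightarrow> real) vlat)"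
  rewrites "(C_lattice (subtopology weak_star (cball 0 1)))\<lparr>carrier := carrier C_ph_ball\<rparr> = C_ph_ball"
    and "topspace (subtopology weak_star (cball 0 1)) = (cball 0 1 :: ('a \<Rightarrow>\<^sub>L real) set)"
proof -
  let ?T = "subtopology weak_star (cball 0 1) :: ('a \<Rightarrow>\<^sub>L real) topology"
  interpret C: pointwise_sublattice ?T "carrier (C_lattice ?T)"
    by (rule pointwise_sublattice_C_lattice)
  have *: "carrier C_ph_ball = {f \<in> carrier (C_lattice ?T). pos_homogeneous_ball f}"
    by (simp add: C_ph_ball_def Let_def)
  \<comment> \<open>Extensional restriction does no harm because the ball is stable under
    multiplication by \<open>t\<close> with \<open>0 \<le> t \<le> 1\<close>.\<close>
  have cb: "pos_homogeneous_ball (restrict f (cball 0 1))" if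
      "\<And>x t. x \<in> cball 0 1 \<Longrightarrow> 0 \<le> t \<Longrightarrow> t \<le> 1 \<Longrightarrow> f (t *\<^sub>R x) = t * f x" for f :: "('a \<Rightarrow>\<^sub>L real) \<Rightarrow> real"
    using that scaleR_in_cball unfolding pos_homogeneous_ball_def by (metis restrict_apply')
  show "pointwise_sublattice ?T (carrier C_ph_ball)"
  proof unfold_locales
  qed (use C.zero_closed C.add_closed C.scale_closed C.max_closed in
      \<open>auto simp del: C_lattice_simps intro!: cb simp: * pos_homogeneous_ball_def mult_le_one algebra_simps max_mult_distrib_left\<close>)
qed (auto simp: C_ph_ball_def Let_def)

interpretation bw: pointwise_sublattice bw_star
    "carrier (C_ph_bw_star :: (('a::real_normed_vector \<Rightarrow>\<^sub>L real) \<Rightarrow> real) vlat)"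
  rewrites "(C_lattice bw_star)\<lparr>carrier := carrier C_ph_bw_star\<rparr> = C_ph_bw_star"
    and "topspace bw_star = (UNIV :: ('a \<Rightarrow>\<^sub>L real) set)"
proof -
  let ?T = "bw_star :: ('a \<Rightarrow>\<^sub>L real) topology"
  interpret C: pointwise_sublattice ?T "carrier (C_lattice ?T)"
    by (rule pointwise_sublattice_C_lattice)
  have *: "carrier C_ph_bw_star = {f \<in> carrier (C_lattice ?T). pos_homogeneous f}"
    by (simp add: C_ph_bw_star_def Let_def)
  show "pointwise_sublattice ?T (carrier C_ph_bw_star)"
  proof unfold_locales
  qed (use C.zero_closed C.add_closed C.scale_closed C.max_closed in
      \<open>auto simp del: C_lattice_simps simp: * pos_homogeneous_def algebra_simps max_mult_distrib_left\<close>)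
qed (auto simp: C_ph_bw_star_def Let_def)

section \<open>Extension from the unit ball and the lattice isomorphism\<close>

text \<open>The radius \<open>1 + norm x\<close> is at least \<open>norm x\<close> and positive even
  at \<open>x = 0\<close>, so one formula serves all points.\<close>

definition homogeneous_extension ::
    "(('a::real_normed_vector \<Rightarrow>\<^sub>L real) \<Rightarrow> real) \<Rightarrow> ('a \<Rightarrow>\<^sub>L real) \<Rightarrow> real" where
  "homogeneous_extension f x = (1 + norm x) * f (x /\<^sub>R (1 + norm x))"

text \<open>Frees the extension from the norm, which need not be weak*-continuous: one constant
  radius may be used on a whole ball.\<close>

lemma homogeneous_extension_eq:
  assumes "pos_homogeneous_ball f" "0 < s" "norm x \<le> s"
  shows "homogeneous_extension f x = s * f (x /\<^sub>R s)"
proof -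
  \<comment> \<open>Either of the radii \<open>s\<close> and \<open>1 + norm x\<close> may be the
    larger one, so both are compared with their sum.\<close>
  have "(s + (1 + norm x)) * f (x /\<^sub>R (s + (1 + norm x))) = s * f (x /\<^sub>R s)"
    using assms by (intro pos_homogeneous_ball_rescale) auto
  moreover have "(s + (1 + norm x)) * f (x /\<^sub>R (s + (1 + norm x))) = homogeneous_extension f x"
    unfolding homogeneous_extension_def
    using assms by (intro pos_homogeneous_ball_rescale) (auto intro: add_pos_nonneg)
  ultimately show ?thesis by simp
qed

lemma homogeneous_extension_on_ball:
  "pos_homogeneous_ball f \<Longrightarrow> x \<in> cball 0 1 \<Longrightarrow> homogeneous_extension f x = f x"
  using homogeneous_extension_eq[of f 1 x] by simp

lemma pos_homogeneous_extension:
  assumes f: "pos_homogeneous_ball f"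
  shows "pos_homogeneous (homogeneous_extension f)"
  unfolding pos_homogeneous_def
proof (intro allI impI)
  fix x :: "'a \<Rightarrow>\<^sub>L real" and t :: real assume "0 \<le> t"
  show "homogeneous_extension f (t *\<^sub>R x) = t * homogeneous_extension f x"
  proof (cases "t = 0")
    case True
    then show ?thesis using pos_homogeneous_ball_0[OF f] by (simp add: homogeneous_extension_def)
  next
    case False
    with \<open>0 \<le> t\<close> have "t > 0" by simp
    define s where "s = 1 + norm x"
    have "0 < s" by (simp add: s_def add_pos_nonneg)
    \<comment> \<open>With radius \<open>t * s\<close> for \<open>t *\<^sub>R x\<close> the rescaled
      argument is again \<open>x /\<^sub>R s\<close>. This radius must be positive, whence the
      separate case \<open>t = 0\<close>.\<close>
    have "homogeneous_extension f (t *\<^sub>R x) = (t * s) * f ((t *\<^sub>R x) /\<^sub>R (t * s))"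
      using f \<open>t > 0\<close> \<open>0 < s\<close> by (intro homogeneous_extension_eq) (auto simp: s_def)
    also have "(t *\<^sub>R x) /\<^sub>R (t * s) = x /\<^sub>R s"
      using \<open>t > 0\<close> by simp
    finally show ?thesis by (simp add: homogeneous_extension_def s_def)
  qed
qed

lemma homogeneous_extension_in_carrier:
  assumes "f \<in> carrier C_ph_ball"
  shows "homogeneous_extension f \<in> carrier C_ph_bw_star"
proof -
  have f: "continuous_map (subtopology weak_star (cball 0 1)) euclideanreal f" "pos_homogeneous_ball f"
    using assms by (auto simp: carrier_C_ph_ball)
  have "continuous_map (subtopology weak_star (cball 0 r)) euclideanreal (homogeneous_extension f)"
    if "r > 0" for r
  proof (rule continuous_map_eq)
    \<comment> \<open>With the constant radius \<open>r\<close>, the extension is a fixed multiple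
      of \<open>f\<close> after a fixed dilation.\<close>
    show "continuous_map (subtopology weak_star (cball 0 r)) euclideanreal (\<lambda>x. r * f (x /\<^sub>R r))"
      using that
      by (intro continuous_map_real_mult_left continuous_map_rescale[OF f(1)])
        (auto simp: field_simps)
  qed (use f(2) that in \<open>simp add: homogeneous_extension_eq dist_norm\<close>)
  with f(2) show ?thesis
    by (simp add: carrier_C_ph_bw_star continuous_map_bw_star_iff pos_homogeneous_extension)
qed

text \<open>Every \<open>x\<close> is a positive multiple of a point of the unit ball.\<close>

lemma pos_homogeneous_eqI:
  fixes f g :: "'a::real_normed_vector \<Rightarrow> real"
  assumes "pos_homogeneous f" "pos_homogeneous g" "\<And>x. x \<in> cball 0 1 \<Longrightarrow> f x = g x"
  shows "f = g"
proof
  fix x :: 'a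
  define s where "s = 1 + norm x"
  have "0 < s" by (simp add: s_def add_pos_nonneg)
  have "f (x /\<^sub>R s) = g (x /\<^sub>R s)"
    using \<open>0 < s\<close> by (intro assms) (simp add: field_simps s_def)
  then have "f (s *\<^sub>R (x /\<^sub>R s)) = g (s *\<^sub>R (x /\<^sub>R s))"
    using assms(1,2) \<open>0 < s\<close> unfolding pos_homogeneous_def by (metis less_imp_le)
  then show "f x = g x" using \<open>0 < s\<close> by simp
qed

lemma restrict_in_C_ph_ball:
  assumes "f \<in> carrier C_ph_bw_star"
  shows "restrict f (cball 0 1) \<in> carrier C_ph_ball"
proof -
  have f: "continuous_map (subtopology weak_star (cball 0 1)) euclideanreal f" "pos_homogeneous f"
    using assms by (auto simp: carrier_C_ph_bw_star continuous_map_bw_star_iff)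
  have "continuous_map (subtopology weak_star (cball 0 1)) euclideanreal (restrict f (cball 0 1))"
    by (rule continuous_map_eq[OF f(1)]) simp
  moreover have "pos_homogeneous_ball (restrict f (cball 0 1))"
    using f(2) scaleR_in_cball unfolding pos_homogeneous_ball_def pos_homogeneous_def
    by (metis restrict_apply')
  ultimately show ?thesis by (simp add: carrier_C_ph_ball)
qed

lemma norm_shrink_le_1: "norm (x /\<^sub>R (1 + norm x)) \<le> 1"
  by (simp add: field_simps add_pos_nonneg)

text \<open>At each \<open>x\<close> the extension is \<open>f\<close> at a point of the ball,
  multiplied by a positive number, and both depend on \<open>x\<close> only; so it respects all
  pointwise operations, maxima and minima included. The inverse is restriction to the ball.\<close>

lemma vlat_isomorphic_C_ph:
  "vlat_isomorphic (C_ph_ball :: (('a::real_normed_vector \<Rightarrow>\<^sub>L real) \<Rightarrow> real) vlat)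
    (C_ph_bw_star :: (('a \<Rightarrow>\<^sub>L real) \<Rightarrow> real) vlat)"
proof -
  let ?E = "homogeneous_extension :: (('a \<Rightarrow>\<^sub>L real) \<Rightarrow> real) \<Rightarrow> _"
  have hom: "?E \<in> vlat_hom C_ph_ball C_ph_bw_star"
    unfolding vlat_hom_def
  proof (intro CollectI conjI ballI allI funcsetI)
    have [simp]: "x /\<^sub>R (1 + norm x) \<in> cball 0 1" "0 \<le> 1 + norm x" for x :: "'a \<Rightarrow>\<^sub>L real"
      by (simp_all add: norm_shrink_le_1 del: norm_scaleR)
    fix f :: "('a \<Rightarrow>\<^sub>L real) \<Rightarrow> real" assume f: "f \<in> carrier C_ph_ball"
    show "?E f \<in> carrier C_ph_bw_star" using f by (rule homogeneous_extension_in_carrier)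
    show "?E (vscale C_ph_ball c f) = vscale C_ph_bw_star c (?E f)" for c
      by (simp add: homogeneous_extension_def fun_eq_iff del: mem_cball mem_cball_0)
    fix g :: "('a \<Rightarrow>\<^sub>L real) \<Rightarrow> real" assume g: "g \<in> carrier C_ph_ball"
    note fg = f g homogeneous_extension_in_carrier[OF f] homogeneous_extension_in_carrier[OF g]
    show "?E (vadd C_ph_ball f g) = vadd C_ph_bw_star (?E f) (?E g)"
      by (simp add: homogeneous_extension_def fun_eq_iff distrib_left del: mem_cball mem_cball_0)
    show "?E (join C_ph_ball f g) = join C_ph_bw_star (?E f) (?E g)"
      using fg by (simp add: ball.join_eq bw.join_eq homogeneous_extension_def fun_eq_iff
          max_mult_distrib_left del: mem_cball mem_cball_0)
    show "?E (meet C_ph_ball f g) = meet C_ph_bw_star (?E f) (?E g)"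
      using fg by (simp add: ball.meet_eq bw.meet_eq homogeneous_extension_def fun_eq_iff
          min_mult_distrib_left del: mem_cball mem_cball_0)
  qed
  have bij: "bij_betw ?E (carrier C_ph_ball) (carrier C_ph_bw_star)"
  proof (rule bij_betwI[where g = "\<lambda>f. restrict f (cball 0 1)"])
    show "?E \<in> carrier C_ph_ball \<rightarrow> carrier C_ph_bw_star"
      by (rule funcsetI) (rule homogeneous_extension_in_carrier)
    show "(\<lambda>f. restrict f (cball 0 1)) \<in> carrier C_ph_bw_star \<rightarrow> (carrier C_ph_ball :: (('a \<Rightarrow>\<^sub>L real) \<Rightarrow> real) set)"
      by (rule funcsetI) (rule restrict_in_C_ph_ball)
  next
    fix f :: "('a \<Rightarrow>\<^sub>L real) \<Rightarrow> real" assume "f \<in> carrier C_ph_ball"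
    then show "restrict (?E f) (cball 0 1) = f"
      by (intro ball.restrict_eqI) (auto simp: carrier_C_ph_ball homogeneous_extension_on_ball)
  next
    fix f :: "('a \<Rightarrow>\<^sub>L real) \<Rightarrow> real" assume f: "f \<in> carrier C_ph_bw_star"
    then have r: "restrict f (cball 0 1) \<in> carrier C_ph_ball" by (rule restrict_in_C_ph_ball)
    \<comment> \<open>Both sides are positively homogeneous, so agreement on the ball
      suffices.\<close>
    show "?E (restrict f (cball 0 1)) = f"
      using f r by (intro pos_homogeneous_eqI)
        (auto simp: carrier_C_ph_ball carrier_C_ph_bw_star pos_homogeneous_extension
          homogeneous_extension_on_ball)
  qed
  show ?thesis
    unfolding vlat_isomorphic_def
    using ball.vector_lattice bw.vector_lattice hom bij by (intro conjI bexI)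
qed

section \<open>Perspectives and regularity\<close>

text \<open>The perspective known from convex analysis: on the half-space \<open>x e > 0\<close> it
  extends \<open>k\<close> homogeneously from the hyperplane \<open>x e = 1\<close>. For
  \<open>x e \<le> 0\<close> the first factor vanishes, so the value of the quotient there,
  including division by \<open>0\<close>, is harmless.\<close>

definition perspective ::
    "'a::real_normed_vector \<Rightarrow> (('a \<Rightarrow>\<^sub>L real) \<Rightarrow> real) \<Rightarrow> ('a \<Rightarrow>\<^sub>L real) \<Rightarrow> real" where
  "perspective e k x = max 0 (blinfun_apply x e) * k (x /\<^sub>R x e)"

lemma pos_homogeneous_perspective: "pos_homogeneous (perspective e k)"
  unfolding pos_homogeneous_def
proof (intro allI impI)
  fix x :: "'a \<Rightarrow>\<^sub>L real" and t :: real assume "0 \<le> t"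
  show "perspective e k (t *\<^sub>R x) = t * perspective e k x"
  proof (cases "t = 0")
    case False
    have "(t *\<^sub>R x) /\<^sub>R (t * blinfun_apply x e) = x /\<^sub>R blinfun_apply x e"
      using False by simp
    then show ?thesis using \<open>0 \<le> t\<close>
      by (simp add: perspective_def blinfun.scaleR_left max_mult_distrib_left del: scaleR_scaleR)
  qed (simp add: perspective_def)
qed

lemma continuous_map_perspective:
  fixes k :: "('a::real_normed_vector \<Rightarrow>\<^sub>L real) \<Rightarrow> real"
  assumes k: "continuous_map bw_star euclideanreal k" and k01: "\<And>x. 0 \<le> k x" "\<And>x. k x \<le> 1"
  shows "continuous_map bw_star euclideanreal (perspective e k)"
  unfolding continuous_map_bw_star_iff
proof (intro allI impI)
  fix r :: real assume r: "r > 0"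
  let ?X = "subtopology weak_star (cball 0 r) :: ('a \<Rightarrow>\<^sub>L real) topology"
  \<comment> \<open>Replacing the divisor by \<open>max a (x e)\<close> keeps the argument of
    \<open>k\<close> in the ball of radius \<open>r / a\<close>, where \<open>k\<close> is
    weak*-continuous.\<close>
  define h where "h = (\<lambda>a (x :: 'a \<Rightarrow>\<^sub>L real).
    max 0 (blinfun_apply x e) * k (inverse (max a (blinfun_apply x e)) *\<^sub>R x))"
  have ev: "continuous_map ?X euclideanreal (\<lambda>x. blinfun_apply x e)"
    by (intro continuous_map_from_subtopology strong_operator_topology_continuous_evaluation)
  have cont: "continuous_map ?X euclideanreal (h a)" if a: "a > 0" for a
    unfolding h_def
  proof (rule continuous_map_real_mult)
    show "continuous_map ?X euclideanreal (\<lambda>x. max 0 (blinfun_apply x e))"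
      by (intro continuous_map_real_max ev) auto
    show "continuous_map ?X euclideanreal (\<lambda>x. k (inverse (max a (blinfun_apply x e)) *\<^sub>R x))"
    proof (rule continuous_map_rescale)
      show "continuous_map (subtopology weak_star (cball 0 (r / a))) euclideanreal k"
        using k r a by (simp add: continuous_map_bw_star_iff)
      show "continuous_map ?X euclideanreal (\<lambda>x. inverse (max a (blinfun_apply x e)))"
        using a by (intro continuous_map_real_inverse continuous_map_real_max ev) (auto simp: max_def)
      show "norm (inverse (max a (blinfun_apply x e)) *\<^sub>R x) \<le> r / a" if "x \<in> cball 0 r" for x
      proof -
        have "norm x * a \<le> r * max a (blinfun_apply x e)"
          using that a r by (intro mult_mono) auto
        then show ?thesis using a by (simp add: field_simps max_def)
      qed
    qed
  qed
  \<comment> \<open>Where \<open>x e \<ge> a\<close> the two functions coincide; elsewhere the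
    factor \<open>max 0 (x e)\<close> is at most \<open>a\<close> and two values of \<open>k\<close>
    differ by at most \<open>1\<close>. The bound is independent of \<open>x\<close>, so the
    convergence is uniform.\<close>
  have near: "\<bar>h a x - perspective e k x\<bar> \<le> a" if a: "a > 0" for a and x :: "'a \<Rightarrow>\<^sub>L real"
  proof (cases "x e \<ge> a")
    case True
    then show ?thesis using a by (simp add: h_def perspective_def max_absorb2)
  next
    case False
    let ?u = "k (inverse (max a (blinfun_apply x e)) *\<^sub>R x)" and ?v = "k (x /\<^sub>R x e)"
    have "\<bar>?u - ?v\<bar> \<le> 1"
      using k01[of "inverse (max a (blinfun_apply x e)) *\<^sub>R x"] k01[of "x /\<^sub>R x e"] by linarith
    then have "max 0 (blinfun_apply x e) * \<bar>?u - ?v\<bar> \<le> max 0 (blinfun_apply x e) * 1"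
      by (intro mult_left_mono) auto
    also have "\<dots> \<le> a" using False a by auto
    finally show ?thesis by (simp add: h_def perspective_def abs_mult flip: right_diff_distrib)
  qed
  have "continuous_map ?X Met_TC.mtopology (perspective e k)"
  proof (rule Met_TC.continuous_map_uniform_limit_alt)
    show "\<forall>\<^sub>F a in at_right 0. continuous_map ?X Met_TC.mtopology (h a)"
      using eventually_at_right_less[of "0::real"] by eventually_elim (use cont in auto)
    show "\<forall>\<^sub>F a in at_right 0. \<forall>x\<in>topspace ?X. dist (h a x) (perspective e k x) < \<epsilon>" if "\<epsilon> > 0" for \<epsilon>
    proof -
      have "\<forall>\<^sub>F a in at_right 0. a \<in> {0<..<\<epsilon>}"
        using that by (rule eventually_at_right_real)
      then show ?thesis
        by eventually_elim (auto simp: dist_real_def intro: le_less_trans[OF near])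
    qed
  qed auto
  then show "continuous_map ?X euclideanreal (perspective e k)" by simp
qed

text \<open>Joins and meets of the ambient lattice are pointwise too, hence lead back into the
  smaller carrier.\<close>

lemma vector_sublattice_C_ph: "vector_sublattice C_ph_bw_star (C_lattice bw_star)"
proof -
  interpret C: pointwise_sublattice bw_star "carrier (C_lattice bw_star)"
    by (rule pointwise_sublattice_C_lattice)
  have V: "C.V = C_lattice bw_star" by simp
  have sub: "f \<in> carrier C_ph_bw_star \<Longrightarrow> f \<in> carrier (C_lattice bw_star)" for f
    using bw.sub by auto
  have lattice: "join (C_lattice bw_star) f g \<in> carrier C_ph_bw_star"
    "meet (C_lattice bw_star) f g \<in> carrier C_ph_bw_star"
    if "f \<in> carrier C_ph_bw_star" "g \<in> carrier C_ph_bw_star" for f g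
    using C.join_eq[OF sub sub, OF that] C.meet_eq[OF sub sub, OF that]
      bw.max_closed[OF that] bw.min_closed[OF that]
    unfolding V topspace_bw_star by simp_all
  have eq: "C_ph_bw_star = (C_lattice bw_star)\<lparr>carrier := carrier C_ph_bw_star\<rparr>"
    by (simp add: C_ph_bw_star_def Let_def)
  show ?thesis
    unfolding vector_sublattice_def C_lattice_simps(4-6) topspace_bw_star
    by (intro conjI ballI allI eq lattice C.vector_lattice[unfolded V]
        bw.sub bw.zero_closed bw.add_closed bw.scale_closed)
qed

lemma is_glb_C_ph:
  assumes P: "P \<noteq> {}" "P \<subseteq> carrier C_ph_bw_star"
    and glb: "is_glb C_ph_bw_star (vzero C_ph_bw_star) P"
  shows "is_glb (C_lattice bw_star) (vzero (C_lattice bw_star)) P"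
proof -
  have nonneg: "0 \<le> p x" if "p \<in> P" for p x
    using glb that P(2) by (auto simp: greatest_def Lower_def)
  have max: "h x \<le> 0" if "h \<in> carrier C_ph_bw_star" "\<And>p x. p \<in> P \<Longrightarrow> h x \<le> p x" for h x
    using glb that by (auto simp: greatest_def Lower_def)
  have le_0: "g x \<le> 0" if g: "continuous_map bw_star euclideanreal g"
    and below: "\<And>p y. p \<in> P \<Longrightarrow> g y \<le> p y" for g x
  proof (rule ccontr)
    assume "\<not> g x \<le> 0"
    then have gx: "g x > 0" by simp
    obtain p where p: "p \<in> P" using P(1) by blast
    \<comment> \<open>Homogeneity makes \<open>p\<close> vanish at the origin, so \<open>g\<close>
      is not positive there and some vector distinguishes \<open>x\<close> from
      \<open>0\<close>.\<close>
    have "p 0 = 0"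
      using p P(2) unfolding carrier_C_ph_bw_star subset_iff pos_homogeneous_def
      by (metis mult_zero_left order_refl scaleR_zero_left)
    then have "x \<noteq> 0" using below[OF p, of x] gx by auto
    then obtain e0 where e0: "x e0 \<noteq> 0"
      by (metis blinfun_eqI zero_blinfun.rep_eq)
    \<comment> \<open>Normalised so that \<open>perspective e k x = k x\<close>.\<close>
    define e where "e = e0 /\<^sub>R x e0"
    have e: "x e = 1" using e0 by (simp add: e_def blinfun.scaleR_right)
    \<comment> \<open>The truncation at \<open>1\<close> gives the bound behind the continuity of
      the perspective, and the one at \<open>0\<close> gives the sign. Since every \<open>p\<close>
      is nonnegative, \<open>k\<close> is still a lower bound.\<close>
    define k where "k = (\<lambda>y. min (max (g y) 0) 1)"
    have k_le: "k y \<le> p y" if "p \<in> P" for p y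
      using below[OF that, of y] nonneg[OF that, of y] by (auto simp: k_def)
    have "continuous_map bw_star euclideanreal k"
      unfolding k_def by (intro continuous_map_real_min continuous_map_real_max g) auto
    then have "perspective e k \<in> carrier C_ph_bw_star"
      by (auto simp: carrier_C_ph_bw_star pos_homogeneous_perspective k_def
          intro!: continuous_map_perspective)
    moreover have "perspective e k y \<le> p y" if pP: "p \<in> P" for p y
    proof (cases "y e > 0")
      case True
      \<comment> \<open>The bound \<open>k \<le> p\<close> is used at \<open>y /\<^sub>R y e\<close>
        only; homogeneity of \<open>p\<close> then carries it to \<open>y\<close>.\<close>
      have "perspective e k y \<le> y e * p (y /\<^sub>R y e)"
        using True k_le[OF pP] by (simp add: perspective_def)
      also have "\<dots> = p (y e *\<^sub>R (y /\<^sub>R y e))"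
        using True pP P(2) unfolding carrier_C_ph_bw_star subset_iff pos_homogeneous_def
        by (metis less_imp_le)
      finally show ?thesis using True by simp
    next
      case False
      then show ?thesis using nonneg[OF pP] by (simp add: perspective_def max_absorb1)
    qed
    \<comment> \<open>The perspective is a lower bound inside the sublattice, where the infimum is
      known to be \<open>0\<close>.\<close>
    ultimately have "perspective e k x \<le> 0" by (rule max)
    then show False using gx e by (simp add: perspective_def k_def min_def split: if_splits)
  qed
  show ?thesis
    using nonneg P(2) bw.sub
    by (auto simp: greatest_def Lower_def restrict_UNIV intro!: le_0)
qed

theorem corollary8p5:
  shows "vlat_isomorphic
           (C_ph_ball :: (('a::real_normed_vector \<Rightarrow>\<^sub>L real) \<Rightarrow> real) vlat)
           (C_ph_bw_star :: (('a \<Rightarrow>\<^sub>L real) \<Rightarrow> real) vlat) \<and>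
         regular_sublattice
           (C_ph_bw_star :: (('a \<Rightarrow>\<^sub>L real) \<Rightarrow> real) vlat)
           (C_lattice bw_star)"
  using vlat_isomorphic_C_ph vector_sublattice_C_ph is_glb_C_ph
  unfolding regular_sublattice_def by blast

end
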